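(* Let $\sigma$ be any subsequence (possibly empty) of $e\,w_l\,w_r\,c$. The Gentzen system $\mathcal{FL}_\sigma$ is equivalent to its external system $\mathbf{e}\mathcal{FL}_\sigma$: there exist translations $\tau'$ from $\mathcal{L}$-sequents to finite sets of $\mathcal{L}$-formulas and $\rho'$ from $\mathcal{L}$-formulas to finite sets of $\mathcal{L}$-sequents, each given by a schema in variables (so commuting with substitutions), such that for every set $\Gamma\cup\{\varphi\}$ of formulas, $\Gamma\vdash_{\mathbf{e}\mathcal{FL}_\sigma}\varphi$ iff $\rho'[\Gamma]\vdash_{\mathcal{FL}_\sigma}\rho'(\varphi)$, and for every sequent $\varsigma$, $\varsigma$ and $\rho'(\tau'(\varsigma))$ are interderivable in $\mathcal{FL}_\sigma$.
   Context: Let $\mathcal{L}$ be the propositional language with binary connectives $\vee,\wedge,*,\backslash,/$, unary connectives $\neg_r$ (right negation) and $\neg_l$ (left negation), and constants $0,1$; formulas are built from a countably infinite set of variables. A sequent is $\Gamma\Rightarrow\Delta$ with $\Gamma$ a finite (possibly empty) sequence of formulas and $\Delta$ a sequence of at most one formula ($\emptyset$ = empty sequence). The calculus $\mathbf{FL}$ has axioms $\varphi\Rightarrow\varphi$, $0\Rightarrow\emptyset$, $\emptyset\Rightarrow 1$ and rules ($\Gamma,\Pi,\Sigma$ finite sequences, $\Delta$ of length $\le1$): (Cut) from $\Gamma\Rightarrow\varphi$ and $\Sigma,\varphi,\Pi\Rightarrow\Delta$ infer $\Sigma,\Gamma,\Pi\Rightarrow\Delta$; ($\vee\Rightarrow$)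 from $\Sigma,\varphi,\Gamma\Rightarrow\Delta$ and $\Sigma,\psi,\Gamma\Rightarrow\Delta$ infer $\Sigma,\varphi\vee\psi,\Gamma\Rightarrow\Delta$; ($\Rightarrow\vee$) from $\Gamma\Rightarrow\varphi$ infer $\Gamma\Rightarrow\varphi\vee\psi$ and $\Gamma\Rightarrow\psi\vee\varphi$; ($\wedge\Rightarrow$) from $\Sigma,\varphi,\Gamma\Rightarrow\Delta$ infer $\Sigma,\varphi\wedge\psi,\Gamma\Rightarrow\Delta$ and $\Sigma,\psi\wedge\varphi,\Gamma\Rightarrow\Delta$; ($\Rightarrow\wedge$) from $\Gamma\Rightarrow\varphi$ and $\Gamma\Rightarrow\psi$ infer $\Gamma\Rightarrow\varphi\wedge\psi$; ($*\Rightarrow$) from $\Sigma,\varphi,\psi,\Gamma\Rightarrow\Delta$ infer $\Sigma,\varphi*\psi,\Gamma\Rightarrow\Delta$; ($\Rightarrow*$) from $\Gamma\Rightarrow\varphi$ and $\Pi\Rightarrow\psi$ infer $\Gamma,\Pi\Rightarrow\varphi*\psi$; ($\backslash\Rightarrow$) from $\Gamma\Rightarrow\varphi$ and $\Sigma,\psi,\Pi\Rightarrow\Delta$ infer $\Sigma,\Gamma,\varphi\backslash\psi,\Pi\Rightarrow\Delta$; ($\Rightarrow\backslash$) from $\varphi,\Gamma\Rightarrow\psi$ infer $\Gamma\Rightarrow\varphi\backslash\psi$; ($/\Rightarrow$) from $\Gamma\Rightarrow\varphi$ and $\Sigma,\psi,\Pi\Rightarrow\Delta$ infer $\Sigma,\psi/\varphi,\Gamma,\Pi\Rightarrow\Delta$;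 ($\Rightarrow/$) from $\Gamma,\varphi\Rightarrow\psi$ infer $\Gamma\Rightarrow\psi/\varphi$; ($\neg_r\Rightarrow$) from $\Gamma\Rightarrow\varphi$ infer $\Gamma,\neg_r\varphi\Rightarrow\emptyset$; ($\Rightarrow\neg_r$) from $\varphi,\Gamma\Rightarrow\emptyset$ infer $\Gamma\Rightarrow\neg_r\varphi$; ($\neg_l\Rightarrow$) from $\Gamma\Rightarrow\varphi$ infer $\neg_l\varphi,\Gamma\Rightarrow\emptyset$; ($\Rightarrow\neg_l$) from $\Gamma,\varphi\Rightarrow\emptyset$ infer $\Gamma\Rightarrow\neg_l\varphi$; ($1\Rightarrow$) from $\Sigma,\Gamma\Rightarrow\Delta$ infer $\Sigma,1,\Gamma\Rightarrow\Delta$; ($\Rightarrow0$) from $\Gamma\Rightarrow\emptyset$ infer $\Gamma\Rightarrow0$. For a subsequence $\sigma$ of $e\,w_l\,w_r\,c$, $\mathbf{FL}_\sigma$ adds the rules coded by the letters of $\sigma$: $e$: from $\Gamma,\varphi,\psi,\Pi\Rightarrow\Delta$ infer $\Gamma,\psi,\varphi,\Pi\Rightarrow\Delta$; $w_l$: from $\Sigma,\Gamma\Rightarrow\Delta$ infer $\Sigma,\varphi,\Gamma\Rightarrow\Delta$; $w_r$: from $\Gamma\Rightarrow\emptyset$ infer $\Gamma\Rightarrow\varphi$; $c$: from $\Sigma,\varphi,\varphi,\Gamma\Rightarrow\Delta$ infer $\Sigma,\varphi,\Gamma\Rightarrow\Delta$. The Gentzen system $\mathcal{FL}_\sigma$: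 $\Phi\vdash\varsigma$ iff there is a finite sequence of sequents ending in $\varsigma$, each an instance of an axiom, a member of $\Phi$, or obtained from earlier ones by an instance of a rule of $\mathbf{FL}_\sigma$. Its external system $\mathbf{e}\mathcal{FL}_\sigma$ is the Hilbert system on formulas with $\Sigma\vdash\varphi$ iff $\{\emptyset\Rightarrow\psi:\psi\in\Sigma\}\vdash_{\mathcal{FL}_\sigma}\emptyset\Rightarrow\varphi$. *)

theory Defs
  imports Main "HOL-Library.Sublist"
begin

text \<open>\<open>LDiv \<phi> \<psi>\<close> is $\varphi \backslash \psi$ and \<open>RDiv \<psi> \<phi>\<close> is $\psi / \varphi$:
  arguments are in the written order, so the numerator of \<open>RDiv\<close> comes first.\<close>

datatype fm =
    Var nat
  | Disj fm fm
  | Conj fm fm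
  | Fus fm fm
  | LDiv fm fm
  | RDiv fm fm
  | NegR fm
  | NegL fm
  | Zero
  | One

datatype sequent = Seq (ante: "fm list") (succ: "fm option")  (infix "\<rhd>" 55)

datatype letter = E | Wl | Wr | C

definition letters :: "letter list" where
  "letters = [E, Wl, Wr, C]"

inductive_set axiom_seqs :: "sequent set" where
  Id: "[\<phi>] \<rhd> Some \<phi> \<in> axiom_seqs"
| ZeroL: "[Zero] \<rhd> None \<in> axiom_seqs"
| OneR: "[] \<rhd> Some One \<in> axiom_seqs"

text \<open>\<open>rule \<sigma> prems s\<close> is a one-step relation, not derivability: \<open>s\<close> follows from the premises
  \<open>prems\<close> by a single rule instance of $\mathbf{FL}_\sigma$.\<close>

inductive rule :: "letter list \<Rightarrow> sequent list \<Rightarrow> sequent \<Rightarrow> bool" for \<sigma> :: "letter list" where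
  Cut: "rule \<sigma> [\<Gamma> \<rhd> Some \<phi>, \<Sigma> @ [\<phi>] @ \<Pi> \<rhd> \<Delta>] (\<Sigma> @ \<Gamma> @ \<Pi> \<rhd> \<Delta>)"
| DisjL: "rule \<sigma> [\<Sigma> @ [\<phi>] @ \<Gamma> \<rhd> \<Delta>, \<Sigma> @ [\<psi>] @ \<Gamma> \<rhd> \<Delta>] (\<Sigma> @ [Disj \<phi> \<psi>] @ \<Gamma> \<rhd> \<Delta>)"
| DisjR1: "rule \<sigma> [\<Gamma> \<rhd> Some \<phi>] (\<Gamma> \<rhd> Some (Disj \<phi> \<psi>))"
| DisjR2: "rule \<sigma> [\<Gamma> \<rhd> Some \<phi>] (\<Gamma> \<rhd> Some (Disj \<psi> \<phi>))"
| ConjL1: "rule \<sigma> [\<Sigma> @ [\<phi>] @ \<Gamma> \<rhd> \<Delta>] (\<Sigma> @ [Conj \<phi> \<psi>] @ \<Gamma> \<rhd> \<Delta>)"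
| ConjL2: "rule \<sigma> [\<Sigma> @ [\<phi>] @ \<Gamma> \<rhd> \<Delta>] (\<Sigma> @ [Conj \<psi> \<phi>] @ \<Gamma> \<rhd> \<Delta>)"
| ConjR: "rule \<sigma> [\<Gamma> \<rhd> Some \<phi>, \<Gamma> \<rhd> Some \<psi>] (\<Gamma> \<rhd> Some (Conj \<phi> \<psi>))"
| FusL: "rule \<sigma> [\<Sigma> @ [\<phi>, \<psi>] @ \<Gamma> \<rhd> \<Delta>] (\<Sigma> @ [Fus \<phi> \<psi>] @ \<Gamma> \<rhd> \<Delta>)"
| FusR: "rule \<sigma> [\<Gamma> \<rhd> Some \<phi>, \<Pi> \<rhd> Some \<psi>] (\<Gamma> @ \<Pi> \<rhd> Some (Fus \<phi> \<psi>))"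
| LDivL: "rule \<sigma> [\<Gamma> \<rhd> Some \<phi>, \<Sigma> @ [\<psi>] @ \<Pi> \<rhd> \<Delta>] (\<Sigma> @ \<Gamma> @ [LDiv \<phi> \<psi>] @ \<Pi> \<rhd> \<Delta>)"
| LDivR: "rule \<sigma> [[\<phi>] @ \<Gamma> \<rhd> Some \<psi>] (\<Gamma> \<rhd> Some (LDiv \<phi> \<psi>))"
| RDivL: "rule \<sigma> [\<Gamma> \<rhd> Some \<phi>, \<Sigma> @ [\<psi>] @ \<Pi> \<rhd> \<Delta>] (\<Sigma> @ [RDiv \<psi> \<phi>] @ \<Gamma> @ \<Pi> \<rhd> \<Delta>)"
| RDivR: "rule \<sigma> [\<Gamma> @ [\<phi>] \<rhd> Some \<psi>] (\<Gamma> \<rhd> Some (RDiv \<psi> \<phi>))"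
| NegRL: "rule \<sigma> [\<Gamma> \<rhd> Some \<phi>] (\<Gamma> @ [NegR \<phi>] \<rhd> None)"
| NegRR: "rule \<sigma> [[\<phi>] @ \<Gamma> \<rhd> None] (\<Gamma> \<rhd> Some (NegR \<phi>))"
| NegLL: "rule \<sigma> [\<Gamma> \<rhd> Some \<phi>] ([NegL \<phi>] @ \<Gamma> \<rhd> None)"
| NegLR: "rule \<sigma> [\<Gamma> @ [\<phi>] \<rhd> None] (\<Gamma> \<rhd> Some (NegL \<phi>))"
| OneL: "rule \<sigma> [\<Sigma> @ \<Gamma> \<rhd> \<Delta>] (\<Sigma> @ [One] @ \<Gamma> \<rhd> \<Delta>)"
| ZeroR: "rule \<sigma> [\<Gamma> \<rhd> None] (\<Gamma> \<rhd> Some Zero)"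
| Exchange: "E \<in> set \<sigma> \<Longrightarrow> rule \<sigma> [\<Gamma> @ [\<phi>, \<psi>] @ \<Pi> \<rhd> \<Delta>] (\<Gamma> @ [\<psi>, \<phi>] @ \<Pi> \<rhd> \<Delta>)"
| WeakL: "Wl \<in> set \<sigma> \<Longrightarrow> rule \<sigma> [\<Sigma> @ \<Gamma> \<rhd> \<Delta>] (\<Sigma> @ [\<phi>] @ \<Gamma> \<rhd> \<Delta>)"
| WeakR: "Wr \<in> set \<sigma> \<Longrightarrow> rule \<sigma> [\<Gamma> \<rhd> None] (\<Gamma> \<rhd> Some \<phi>)"
| Contr: "C \<in> set \<sigma> \<Longrightarrow> rule \<sigma> [\<Sigma> @ [\<phi>, \<phi>] @ \<Gamma> \<rhd> \<Delta>] (\<Sigma> @ [\<phi>] @ \<Gamma> \<rhd> \<Delta>)"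

definition is_derivation :: "letter list \<Rightarrow> sequent set \<Rightarrow> sequent list \<Rightarrow> bool" where
  "is_derivation \<sigma> \<Phi> ds \<longleftrightarrow>
     (\<forall>i < length ds. ds ! i \<in> axiom_seqs \<or> ds ! i \<in> \<Phi> \<or>
        (\<exists>prems. rule \<sigma> prems (ds ! i) \<and> set prems \<subseteq> set (take i ds)))"

definition FL :: "letter list \<Rightarrow> sequent set \<Rightarrow> sequent \<Rightarrow> bool" where
  "FL \<sigma> \<Phi> s \<longleftrightarrow> (\<exists>ds. ds \<noteq> [] \<and> last ds = s \<and> is_derivation \<sigma> \<Phi> ds)"

definition FL_set :: "letter list \<Rightarrow> sequent set \<Rightarrow> sequent set \<Rightarrow> bool" where
  "FL_set \<sigma> \<Phi> \<Psi> \<longleftrightarrow> (\<forall>s\<in>\<Psi>. FL \<sigma> \<Phi> s)"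

definition interderivable :: "letter list \<Rightarrow> sequent set \<Rightarrow> sequent set \<Rightarrow> bool" where
  "interderivable \<sigma> \<Phi> \<Psi> \<longleftrightarrow> FL_set \<sigma> \<Phi> \<Psi> \<and> FL_set \<sigma> \<Psi> \<Phi>"

definition eFL :: "letter list \<Rightarrow> fm set \<Rightarrow> fm \<Rightarrow> bool" where
  "eFL \<sigma> \<Sigma> \<phi> \<longleftrightarrow> FL \<sigma> ((\<lambda>\<psi>. [] \<rhd> Some \<psi>) ` \<Sigma>) ([] \<rhd> Some \<phi>)"

primrec vars :: "fm \<Rightarrow> nat set" where
  "vars (Var x) = {x}"
| "vars (Disj \<phi> \<psi>) = vars \<phi> \<union> vars \<psi>"
| "vars (Conj \<phi> \<psi>) = vars \<phi> \<union> vars \<psi>"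
| "vars (Fus \<phi> \<psi>) = vars \<phi> \<union> vars \<psi>"
| "vars (LDiv \<phi> \<psi>) = vars \<phi> \<union> vars \<psi>"
| "vars (RDiv \<phi> \<psi>) = vars \<phi> \<union> vars \<psi>"
| "vars (NegR \<phi>) = vars \<phi>"
| "vars (NegL \<phi>) = vars \<phi>"
| "vars Zero = {}"
| "vars One = {}"

primrec subst :: "(nat \<Rightarrow> fm) \<Rightarrow> fm \<Rightarrow> fm" where
  "subst f (Var x) = f x"
| "subst f (Disj \<phi> \<psi>) = Disj (subst f \<phi>) (subst f \<psi>)"
| "subst f (Conj \<phi> \<psi>) = Conj (subst f \<phi>) (subst f \<psi>)"
| "subst f (Fus \<phi> \<psi>) = Fus (subst f \<phi>) (subst f \<psi>)"
| "subst f (LDiv \<phi> \<psi>) = LDiv (subst f \<phi>) (subst f \<psi>)"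
| "subst f (RDiv \<phi> \<psi>) = RDiv (subst f \<phi>) (subst f \<psi>)"
| "subst f (NegR \<phi>) = NegR (subst f \<phi>)"
| "subst f (NegL \<phi>) = NegL (subst f \<phi>)"
| "subst f Zero = Zero"
| "subst f One = One"

fun fms :: "sequent \<Rightarrow> fm list" where
  "fms (\<Gamma> \<rhd> None) = \<Gamma>"
| "fms (\<Gamma> \<rhd> Some \<phi>) = \<Gamma> @ [\<phi>]"

definition vars_seq :: "sequent \<Rightarrow> nat set" where
  "vars_seq s = \<Union> (vars ` set (fms s))"

definition subst_seq :: "(nat \<Rightarrow> fm) \<Rightarrow> sequent \<Rightarrow> sequent" where
  "subst_seq f s = (map (subst f) (ante s) \<rhd> map_option (subst f) (succ s))"

text \<open>A translation of sequents is given by one finite set \<open>T m b\<close> of formulas for each sequent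
  type: \<open>m\<close> is the length of the left-hand side and \<open>b\<close> tells whether the right-hand side is
  nonempty.  The schema's variables \<open>Var 0, Var 1, \<dots>\<close> stand for the formulas of the sequent,
  left to right, the succedent (if any) being last.\<close>

definition seq_translation :: "(sequent \<Rightarrow> fm set) \<Rightarrow> bool" where
  "seq_translation \<tau> \<longleftrightarrow>
     (\<exists>T :: nat \<Rightarrow> bool \<Rightarrow> fm set.
        (\<forall>m b. finite (T m b) \<and>
           (\<forall>\<chi>\<in>T m b. vars \<chi> \<subseteq> {..<(if b then Suc m else m)})) \<and>
        (\<forall>s. \<tau> s = subst (\<lambda>i. fms s ! i) ` T (length (ante s)) (succ s \<noteq> None)))"

definition fm_translation :: "(fm \<Rightarrow> sequent set) \<Rightarrow> bool" where
  "fm_translation \<rho> \<longleftrightarrow>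
     (\<exists>R. finite R \<and> (\<forall>s\<in>R. vars_seq s \<subseteq> {0}) \<and>
        (\<forall>\<phi>. \<rho> \<phi> = subst_seq (\<lambda>_. \<phi>) ` R))"

text \<open>Translations commute with substitutions and have finite values.\<close>

lemma subst_subst: "subst f (subst g \<phi>) = subst (\<lambda>x. subst f (g x)) \<phi>"
  by (induction \<phi>) auto

lemma subst_cong_vars: "(\<And>x. x \<in> vars \<phi> \<Longrightarrow> f x = g x) \<Longrightarrow> subst f \<phi> = subst g \<phi>"
  by (induction \<phi>) auto

lemma seq_translation_finite: "seq_translation \<tau> \<Longrightarrow> finite (\<tau> s)"
  by (auto simp: seq_translation_def)

lemma seq_translation_subst:
  assumes "seq_translation \<tau>"
  shows "\<tau> (subst_seq f s) = subst f ` \<tau> s"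
proof -
  from assms obtain T where
    v: "\<And>m b \<chi>. \<chi> \<in> T m b \<Longrightarrow> vars \<chi> \<subseteq> {..<(if b then Suc m else m)}" and
    t: "\<And>s. \<tau> s = subst (\<lambda>i. fms s ! i) ` T (length (ante s)) (succ s \<noteq> None)"
    unfolding seq_translation_def by blast
  have m: "fms (subst_seq f s) = map (subst f) (fms s)"
    by (cases s rule: fms.cases) (auto simp: subst_seq_def)
  have l: "length (fms s) = (if succ s \<noteq> None then Suc (length (ante s)) else length (ante s))"
    by (cases s rule: fms.cases) auto
  have "subst (\<lambda>i. fms (subst_seq f s) ! i) \<chi> = subst f (subst (\<lambda>i. fms s ! i) \<chi>)"
    if "\<chi> \<in> T (length (ante s)) (succ s \<noteq> None)" for \<chi>
  proof -
    have "x < length (fms s)" if "x \<in> vars \<chi>" for x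
      unfolding l using v[OF \<open>\<chi> \<in> _\<close>] that by blast
    then show ?thesis
      unfolding subst_subst by (intro subst_cong_vars) (simp add: m)
  qed
  then show ?thesis
    by (auto simp: t image_image subst_seq_def intro!: image_cong)
qed

lemma fm_translation_finite: "fm_translation \<rho> \<Longrightarrow> finite (\<rho> \<phi>)"
  by (auto simp: fm_translation_def)

lemma fm_translation_subst:
  assumes "fm_translation \<rho>"
  shows "\<rho> (subst f \<phi>) = subst_seq f ` \<rho> \<phi>"
  using assms
  by (auto simp: fm_translation_def subst_seq_def image_image subst_subst option.map_comp comp_def)

end

theory Submission
  imports Defs
begin

text \<open>The translations are $\rho'(\varphi) = \{\emptyset \Rightarrow \varphi\}$ and
  $\tau'(\varphi_1,\dots,\varphi_m \Rightarrow \varphi) =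
  \{\varphi_m \backslash (\cdots \backslash (\varphi_1 \backslash \varphi))\}$, with $0$ in place of an
  empty succedent. By ($\Rightarrow\backslash$), ($\backslash\Rightarrow$) and (Cut), the sequents
  $\varphi,\Gamma \Rightarrow \psi$ and $\Gamma \Rightarrow \varphi\backslash\psi$ are
  interderivable, so the antecedent can be moved to the right one formula at a time.\<close>

text \<open>Entries of \<open>es\<close> keep their justification: the entries before position
  \<open>i - length ds\<close> of \<open>es\<close> all lie in
  \<open>take i (ds @ es)\<close>.\<close>

lemma is_derivation_append:
  assumes "is_derivation \<sigma> \<Phi> ds" "is_derivation \<sigma> \<Phi> es"
  shows "is_derivation \<sigma> \<Phi> (ds @ es)"
  unfolding is_derivation_def
proof (intro allI impI)
  fix i assume i: "i < length (ds @ es)"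
  let ?s = "(ds @ es) ! i"
  show "?s \<in> axiom_seqs \<or> ?s \<in> \<Phi> \<or>
    (\<exists>prems. rule \<sigma> prems ?s \<and> set prems \<subseteq> set (take i (ds @ es)))"
  proof (cases "i < length ds")
    case True
    with assms(1) show ?thesis
      by (auto simp: is_derivation_def nth_append)
  next
    case False
    with i have "i - length ds < length es" by auto
    with assms(2) False show ?thesis
      unfolding is_derivation_def by (fastforce simp: nth_append)
  qed
qed

lemma is_derivation_snoc:
  assumes "is_derivation \<sigma> \<Phi> ds"
    and "s \<in> axiom_seqs \<or> s \<in> \<Phi> \<or> (\<exists>prems. rule \<sigma> prems s \<and> set prems \<subseteq> set ds)"
  shows "is_derivation \<sigma> \<Phi> (ds @ [s])"
  using assms by (auto simp: is_derivation_def nth_append less_Suc_eq)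

lemma FL_initial:
  assumes "s \<in> axiom_seqs \<or> s \<in> \<Phi>"
  shows "FL \<sigma> \<Phi> s"
proof -
  have "is_derivation \<sigma> \<Phi> []" by (simp add: is_derivation_def)
  then have "is_derivation \<sigma> \<Phi> ([] @ [s])"
    using assms by (intro is_derivation_snoc) auto
  then show ?thesis unfolding FL_def by (intro exI[of _ "[s]"]) simp
qed

text \<open>A rule step needs all its premises in one list, while each premise comes with a
  derivation of its own; concatenation merges them.\<close>

lemma FL_common_derivation:
  assumes "\<forall>p\<in>set ps. FL \<sigma> \<Phi> p"
  shows "\<exists>ds. is_derivation \<sigma> \<Phi> ds \<and> set ps \<subseteq> set ds"
  using assms
proof (induction ps)
  case Nil
  show ?case by (intro exI[of _ "[]"]) (simp add: is_derivation_def)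
next
  case (Cons p ps)
  then obtain ds where ds: "is_derivation \<sigma> \<Phi> ds" "set ps \<subseteq> set ds" by auto
  from Cons.prems obtain es where es: "es \<noteq> []" "last es = p" "is_derivation \<sigma> \<Phi> es"
    by (auto simp: FL_def)
  have "p \<in> set es" using es last_in_set by blast
  with ds es show ?case
    by (intro exI[of _ "es @ ds"]) (auto intro: is_derivation_append)
qed

text \<open>Together with \<open>FL_initial\<close> this replaces derivation lists: all later
  arguments only use closure of \<open>FL\<close> under axioms, hypotheses and rules.\<close>

lemma FL_rule:
  assumes "rule \<sigma> prems s" "\<forall>p\<in>set prems. FL \<sigma> \<Phi> p"
  shows "FL \<sigma> \<Phi> s"
proof -
  obtain ds where "is_derivation \<sigma> \<Phi> ds" "set prems \<subseteq> set ds"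
    using FL_common_derivation[OF assms(2)] by blast
  then have "is_derivation \<sigma> \<Phi> (ds @ [s])"
    using assms(1) by (intro is_derivation_snoc) auto
  then show ?thesis unfolding FL_def by (intro exI[of _ "ds @ [s]"]) simp
qed

lemma FL_cut:
  assumes "FL \<sigma> \<Phi> (\<Gamma> \<rhd> Some \<phi>)" "FL \<sigma> \<Phi> (\<Sigma> @ [\<phi>] @ \<Pi> \<rhd> \<Delta>)"
  shows "FL \<sigma> \<Phi> (\<Sigma> @ \<Gamma> @ \<Pi> \<rhd> \<Delta>)"
  using FL_rule[OF rule.Cut] assms by simp

lemma FL_LDiv_iff: "FL \<sigma> \<Phi> (\<Gamma> \<rhd> Some (LDiv \<phi> \<psi>)) \<longleftrightarrow> FL \<sigma> \<Phi> (\<phi> # \<Gamma> \<rhd> Some \<psi>)"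
proof
  assume l: "FL \<sigma> \<Phi> (\<Gamma> \<rhd> Some (LDiv \<phi> \<psi>))"
  \<comment> \<open>Modus ponens as a sequent, from two identity axioms; a cut against it inverts
    the right rule for \<open>LDiv\<close>.\<close>
  have "FL \<sigma> \<Phi> ([] @ [\<phi>] @ [LDiv \<phi> \<psi>] @ [] \<rhd> Some \<psi>)"
    by (rule FL_rule[OF rule.LDivL]) (auto intro!: FL_initial axiom_seqs.Id)
  with FL_cut[OF l, of "[\<phi>]" "[]" "Some \<psi>"] show "FL \<sigma> \<Phi> (\<phi> # \<Gamma> \<rhd> Some \<psi>)" by simp
next
  assume "FL \<sigma> \<Phi> (\<phi> # \<Gamma> \<rhd> Some \<psi>)"
  then show "FL \<sigma> \<Phi> (\<Gamma> \<rhd> Some (LDiv \<phi> \<psi>))"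
    by (intro FL_rule[OF rule.LDivR]) simp
qed

lemma FL_Zero_iff: "FL \<sigma> \<Phi> (\<Gamma> \<rhd> Some Zero) \<longleftrightarrow> FL \<sigma> \<Phi> (\<Gamma> \<rhd> None)"
proof
  assume l: "FL \<sigma> \<Phi> (\<Gamma> \<rhd> Some Zero)"
  have "FL \<sigma> \<Phi> ([Zero] \<rhd> None)"
    by (auto intro: FL_initial axiom_seqs.ZeroL)
  with FL_cut[OF l, of "[]" "[]" None] show "FL \<sigma> \<Phi> (\<Gamma> \<rhd> None)" by simp
next
  assume "FL \<sigma> \<Phi> (\<Gamma> \<rhd> None)"
  then show "FL \<sigma> \<Phi> (\<Gamma> \<rhd> Some Zero)"
    by (intro FL_rule[OF rule.ZeroR]) simp
qed

text \<open>The right rule for \<open>LDiv\<close> takes formulas from the left end of the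
  antecedent, so the head of the list must become the innermost divisor; hence
  \<open>foldl\<close>.\<close>

definition ldivs :: "fm list \<Rightarrow> fm \<Rightarrow> fm" where
  "ldivs \<Gamma> \<psi> = foldl (\<lambda>\<chi> \<phi>. LDiv \<phi> \<chi>) \<psi> \<Gamma>"

definition fm_of_seq :: "sequent \<Rightarrow> fm" where
  "fm_of_seq s = ldivs (ante s) (case succ s of None \<Rightarrow> Zero | Some \<phi> \<Rightarrow> \<phi>)"

text \<open>\<open>foldl\<close> absorbs the head \<phi> of the list into the accumulator, so the
  induction hypothesis is applied with \<open>LDiv \<phi> \<psi>\<close> for \<psi>, and
  \<open>FL_LDiv_iff\<close> then releases \<phi> at the left end.\<close>

lemma FL_ldivs_iff: "FL \<sigma> \<Phi> (\<Delta> \<rhd> Some (ldivs \<Gamma> \<psi>)) \<longleftrightarrow> FL \<sigma> \<Phi> (\<Gamma> @ \<Delta> \<rhd> Some \<psi>)"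
  unfolding ldivs_def by (induction \<Gamma> arbitrary: \<psi>) (simp_all add: FL_LDiv_iff)

text \<open>As \<Phi> is arbitrary, this one equivalence yields both halves of
  interderivability.\<close>

lemma FL_fm_of_seq_iff: "FL \<sigma> \<Phi> ([] \<rhd> Some (fm_of_seq s)) \<longleftrightarrow> FL \<sigma> \<Phi> s"
  by (cases s) (auto simp: fm_of_seq_def FL_ldivs_iff FL_Zero_iff split: option.split)

lemma subst_ldivs: "subst f (ldivs \<Gamma> \<psi>) = ldivs (map (subst f) \<Gamma>) (subst f \<psi>)"
  unfolding ldivs_def by (induction \<Gamma> arbitrary: \<psi>) simp_all

lemma vars_ldivs: "vars (ldivs \<Gamma> \<psi>) = \<Union> (vars ` set \<Gamma>) \<union> vars \<psi>"
  unfolding ldivs_def by (induction \<Gamma> arbitrary: \<psi>) auto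

lemma seq_translation_fm_of_seq: "seq_translation (\<lambda>s. {fm_of_seq s})"
proof -
  \<comment> \<open>The translation of the generic sequent with antecedent \<open>Var 0\<close>,
    ..., \<open>Var (m - 1)\<close>; its succedent, if any, is \<open>Var m\<close>, since
    \<open>fms\<close> lists the succedent last.\<close>
  define X where "X m b = ldivs (map Var [0..<m]) (if b then Var m else Zero)" for m b
  have "vars (X m b) \<subseteq> {..<(if b then Suc m else m)}" for m b
    by (auto simp: X_def vars_ldivs)
  moreover have "fm_of_seq s = subst (\<lambda>i. fms s ! i) (X (length (ante s)) (succ s \<noteq> None))" for s
  proof -
    have "map (\<lambda>i. fms s ! i) [0..<length (ante s)] = ante s"
      by (cases s rule: fms.cases) (auto simp: nth_append intro!: nth_equalityI)
    then show ?thesis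
      by (cases s rule: fms.cases) (simp_all add: X_def fm_of_seq_def subst_ldivs comp_def)
  qed
  ultimately show ?thesis
    unfolding seq_translation_def by (intro exI[of _ "\<lambda>m b. {X m b}"]) simp
qed

lemma fm_translation_theorem: "fm_translation (\<lambda>\<phi>. {[] \<rhd> Some \<phi>})"
  unfolding fm_translation_def
  by (intro exI[of _ "{[] \<rhd> Some (Var 0)}"]) (simp add: vars_seq_def subst_seq_def)

theorem theorem26:
  fixes \<sigma> :: "letter list"
  assumes "subseq \<sigma> letters"
  shows "\<exists>(\<tau> :: sequent \<Rightarrow> fm set) (\<rho> :: fm \<Rightarrow> sequent set).
    seq_translation \<tau> \<and> fm_translation \<rho> \<and>
    (\<forall>\<Gamma> \<phi>. eFL \<sigma> \<Gamma> \<phi> \<longleftrightarrow> FL_set \<sigma> (\<Union> (\<rho> ` \<Gamma>)) (\<rho> \<phi>)) \<and>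
    (\<forall>s. interderivable \<sigma> {s} (\<Union> (\<rho> ` \<tau> s)))"
proof (intro exI conjI allI)
  show "seq_translation (\<lambda>s. {fm_of_seq s})" by (rule seq_translation_fm_of_seq)
  show "fm_translation (\<lambda>\<phi>. {[] \<rhd> Some \<phi>})" by (rule fm_translation_theorem)
  show "eFL \<sigma> \<Gamma> \<phi> \<longleftrightarrow> FL_set \<sigma> (\<Union>\<psi>\<in>\<Gamma>. {[] \<rhd> Some \<psi>}) {[] \<rhd> Some \<phi>}" for \<Gamma> \<phi>
    by (simp add: eFL_def FL_set_def UNION_singleton_eq_range)
  fix s
  have "FL \<sigma> {s} ([] \<rhd> Some (fm_of_seq s))"
    unfolding FL_fm_of_seq_iff by (simp add: FL_initial)
  moreover have "FL \<sigma> {[] \<rhd> Some (fm_of_seq s)} s"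
    \<comment> \<open>Fixing \<open>s\<close> keeps the reversed equation from rewriting its own
      result forever.\<close>
    unfolding FL_fm_of_seq_iff[symmetric, of _ _ s] by (simp add: FL_initial)
  ultimately show "interderivable \<sigma> {s} (\<Union>\<psi>\<in>{fm_of_seq s}. {[] \<rhd> Some \<psi>})"
    by (simp add: interderivable_def FL_set_def)
qed

end
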